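(* For every $p\in(0,1)$ and every $\lambda\in(0,1]$, one has the proper inclusions $\mathcal{U}_p(\lambda)\subsetneq\mathcal{V}_p(\lambda)\subsetneq\Sigma(p)$.
   Context: $\mathbb{D}=\{z\in\mathbb{C}:|z|<1\}$. For $p\in(0,1)$, $\mathcal{A}(p)$ is the class of all functions $f$ that are holomorphic in $\mathbb{D}\setminus\{p\}$, have a simple pole at $z=p$ (with nonzero residue), and satisfy $f(0)=0$ and $f'(0)=1$. $\Sigma(p)$ is the set of $f\in\mathcal{A}(p)$ that are one-to-one in $\mathbb{D}$ (as maps into the Riemann sphere, with $f(p)=\infty$). For $f\in\mathcal{A}(p)$ put $U_f(z)=\left(\frac{z}{f(z)}\right)^2 f'(z)-1$, regarded as a meromorphic function on $\mathbb{D}$ with removable singularities (in particular at $z=0$ and $z=p$) filled in; a bound $|U_f(z)|<c$ for all $z\in\mathbb{D}$ includes the requirement that $U_f$ has no poles in $\mathbb{D}$. For $\lambda\in(0,1]$ define $$\mathcal{U}_p(\lambda)=\{f\in\mathcal{A}(p): |U_f(z)|<\lambda\mu \text{ for all } z\in\mathbb{D}\},\quad \mu=\left(\frac{1-p}{1+p}\right)^2,$$ $$\mathcal{V}_p(\lambda)=\{f\in\mathcal{A}(p): |U_f(z)|<\lambda \text{ for all } z\in\mathbb{D}\}.$$ *)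

theory Defs
  imports "HOL-Complex_Analysis.Complex_Analysis"
begin

(* Functions on the unit disc are total functions on the complex numbers. Values at the pole p and
   outside the disc are irrelevant: membership in each class below depends only on the
   values on ball 0 1 - {p}, so a proper inclusion of these sets is a proper inclusion of
   classes of functions on the punctured disc. *)

definition class_A :: "real \<Rightarrow> (complex \<Rightarrow> complex) set" where
  "class_A p = {f. f holomorphic_on (ball 0 1 - {of_real p})
      \<and> is_pole f (of_real p) \<and> zorder f (of_real p) = -1
      \<and> f 0 = 0 \<and> deriv f 0 = 1}"

(* The map into the Riemann sphere induced by f, with None as the point at infinity. *)
definition sphere_map :: "real \<Rightarrow> (complex \<Rightarrow> complex) \<Rightarrow> complex \<Rightarrow> complex option" where
  "sphere_map p f z = (if z = of_real p then None else Some (f z))"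

definition class_Sigma :: "real \<Rightarrow> (complex \<Rightarrow> complex) set" where
  "class_Sigma p = {f \<in> class_A p. inj_on (sphere_map p f) (ball 0 1)}"

definition U_op :: "(complex \<Rightarrow> complex) \<Rightarrow> complex \<Rightarrow> complex" where
  "U_op f = remove_sings (\<lambda>z. (z / f z)\<^sup>2 * deriv f z - 1)"

(* remove_sings takes the value 0 at poles, so their absence is required separately. *)
definition U_bounded :: "(complex \<Rightarrow> complex) \<Rightarrow> real \<Rightarrow> bool" where
  "U_bounded f c \<longleftrightarrow> (\<forall>z\<in>ball 0 1. \<not> is_pole (U_op f) z \<and> norm (U_op f z) < c)"

definition mu :: "real \<Rightarrow> real" where
  "mu p = ((1 - p) / (1 + p))\<^sup>2"

definition class_U :: "real \<Rightarrow> real \<Rightarrow> (complex \<Rightarrow> complex) set" where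
  "class_U p l = {f \<in> class_A p. U_bounded f (l * mu p)}"

definition class_V :: "real \<Rightarrow> real \<Rightarrow> (complex \<Rightarrow> complex) set" where
  "class_V p l = {f \<in> class_A p. U_bounded f l}"

end

theory Submission
  imports Defs
begin

text \<open>
  Writing \<open>f = z / N\<close> turns \<open>U_f\<close> into \<open>N - z N' - 1\<close>; with \<open>N = 1 + z w\<close>, that is
  \<open>1 / f = 1 / z + w\<close>, it equals \<open>- z\<^sup>2 w'\<close>. If \<open>\<bar>U_f\<bar> < \<lambda>\<close>, then \<open>f\<close> has no zero besides \<open>0\<close>
  (another one would be a pole of \<open>U_f\<close>), so \<open>w\<close> is holomorphic in the disc, and the maximum
  principle gives \<open>\<bar>w'\<bar> \<le> \<lambda>\<close>. If \<open>f a = f b\<close> with \<open>a \<noteq> b\<close>, then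
  \<open>\<bar>a - b\<bar> / \<bar>a b\<bar> = \<bar>w a - w b\<bar> \<le> \<lambda> \<bar>a - b\<bar>\<close>, which contradicts \<open>\<lambda> \<bar>a b\<bar> < 1\<close>.

  The inclusions are proper: \<open>N = (1 - z / p) (1 - \<lambda> p z)\<close> has \<open>U_f = - \<lambda> z\<^sup>2\<close>, and the univalent
  function \<open>k = 2 (1 - \<surd>(1 - z))\<close> yields \<open>f\<close> with \<open>1 / f = 1 / k - 1 / k(p)\<close>, for which \<open>U_f = U_k\<close>
  is unbounded near \<open>1\<close>.
\<close>

section \<open>The operator \<open>U_op\<close> on quotients \<open>z / N z\<close>\<close>

text \<open>Off \<open>0\<close> and \<open>a\<close> this is the quotient rule. The right-hand side
  is continuous on the whole disc, so at the exceptional points it is the limit that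
  \<open>remove_sings\<close> fills in. The point \<open>a\<close>, where \<open>N\<close> may
  vanish, is the prospective pole of the quotient.\<close>

lemma U_op_quotient:
  assumes hol: "N holomorphic_on ball 0 1"
    and nz: "\<And>z. z \<in> ball 0 1 \<Longrightarrow> z \<noteq> a \<Longrightarrow> N z \<noteq> 0"
    and z: "z \<in> ball 0 1"
  shows "U_op (\<lambda>z. z / N z) z = N z - z * deriv N z - 1"
proof -
  have expr: "N w - w * deriv N w - 1 = (w / (w / N w))\<^sup>2 * deriv (\<lambda>z. z / N z) w - 1"
    if w: "w \<in> ball 0 1" "w \<noteq> 0" "w \<noteq> a" for w
  proof -
    have "(N has_field_derivative deriv N w) (at w)"
      using hol w holomorphic_derivI open_ball by blast
    then have "((\<lambda>z. z / N z) has_field_derivative (N w - w * deriv N w) / (N w * N w)) (at w)"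
      using nz[OF w(1,3)] by (auto intro!: derivative_eq_intros)
    then have "deriv (\<lambda>z. z / N z) w = (N w - w * deriv N w) / (N w * N w)"
      by (rule DERIV_imp_deriv)
    then show ?thesis
      using w nz[OF w(1,3)] by (simp add: power2_eq_square)
  qed
  have "eventually (\<lambda>w. w \<in> ball 0 1 - {z}) (at z)"
    using z by (intro eventually_at_in_open) auto
  moreover have "eventually (\<lambda>w. w \<noteq> 0) (at z)" "eventually (\<lambda>w. w \<noteq> a) (at z)"
    by (auto intro: eventually_neq_at_within)
  ultimately have ev: "eventually (\<lambda>w. N w - w * deriv N w - 1
      = (w / (w / N w))\<^sup>2 * deriv (\<lambda>z. z / N z) w - 1) (at z)"
    by eventually_elim (use expr in auto)
  have "(\<lambda>w. N w - w * deriv N w - 1) holomorphic_on ball 0 1"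
    by (intro holomorphic_intros hol) auto
  then have "isCont (\<lambda>w. N w - w * deriv N w - 1) z"
    using z by (meson continuous_on_eq_continuous_at holomorphic_on_imp_continuous_on open_ball)
  then have "(\<lambda>w. N w - w * deriv N w - 1) \<midarrow>z\<rightarrow> N z - z * deriv N z - 1"
    by (simp add: isCont_def)
  then have "(\<lambda>w. (w / (w / N w))\<^sup>2 * deriv (\<lambda>z. z / N z) w - 1) \<midarrow>z\<rightarrow> N z - z * deriv N z - 1"
    using tendsto_cong[OF ev] by blast
  then show ?thesis
    unfolding U_op_def by (rule remove_sings_eqI)
qed

text \<open>The clause about poles is automatic: on the disc \<open>U_op\<close> coincides with a
  holomorphic function.\<close>

lemma U_bounded_quotient:
  assumes hol: "N holomorphic_on ball 0 1"
    and nz: "\<And>z. z \<in> ball 0 1 \<Longrightarrow> z \<noteq> a \<Longrightarrow> N z \<noteq> 0"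
  shows "U_bounded (\<lambda>z. z / N z) c \<longleftrightarrow> (\<forall>z\<in>ball 0 1. norm (N z - z * deriv N z - 1) < c)"
proof -
  have "\<not> is_pole (U_op (\<lambda>z. z / N z)) z" if z: "z \<in> ball 0 1" for z
  proof -
    have "(\<lambda>w. N w - w * deriv N w - 1) holomorphic_on ball 0 1"
      by (intro holomorphic_intros hol) auto
    then have "U_op (\<lambda>z. z / N z) holomorphic_on ball 0 1"
      by (rule holomorphic_transform) (use U_op_quotient[OF hol nz] in auto)
    then show ?thesis
      using not_is_pole_holomorphic[OF open_ball z] by blast
  qed
  then show ?thesis
    using U_op_quotient[OF hol nz] by (simp add: U_bounded_def)
qed

text \<open>The zero of \<open>N\<close> at \<open>p\<close> is simple, so dividing it out leaves a
  zero-free holomorphic \<open>M\<close>. Then \<open>z / N z\<close> is \<open>z / M z\<close>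
  divided by \<open>z - p\<close>, with a numerator that does not vanish at
  \<open>p\<close>.\<close>

lemma quotient_in_class_A:
  assumes hol: "N holomorphic_on ball 0 1"
    and nz: "\<And>z. z \<in> ball 0 1 \<Longrightarrow> z \<noteq> of_real p \<Longrightarrow> N z \<noteq> 0"
    and p: "0 < p" "p < 1" and N: "N 0 = 1" "N (of_real p) = 0" "deriv N (of_real p) \<noteq> 0"
  shows "(\<lambda>z. z / N z) \<in> class_A p"
proof -
  let ?p = "complex_of_real p"
  define M where "M = (\<lambda>z. if z = ?p then deriv N ?p else (N z - N ?p) / (z - ?p))"
  have pin: "?p \<in> ball 0 1" using p by simp
  have M: "M holomorphic_on ball 0 1"
    unfolding M_def using pole_lemma_open[OF hol open_ball] .
  have Mnz: "M z \<noteq> 0" if "z \<in> ball 0 1" for z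
    using nz[OF that] N by (auto simp: M_def)
  have quot: "(\<lambda>z. z / M z) holomorphic_on ball 0 1"
    by (intro holomorphic_intros M) (use Mnz in auto)
  have fact: "z / N z = z / M z / (z - ?p)" if "z \<noteq> ?p" for z
    using that N by (simp add: M_def)
  have "is_pole (\<lambda>z. z / M z / (z - ?p) ^ 1) ?p"
    by (rule is_pole_basic[OF quot open_ball pin]) (use p Mnz[OF pin] in auto)
  moreover have "eventually (\<lambda>z. z / M z / (z - ?p) ^ 1 = z / N z) (at ?p)"
    using eventually_neq_at_within[of ?p ?p UNIV]
    by eventually_elim (metis fact power_one_right)
  ultimately have pole: "is_pole (\<lambda>z. z / N z) ?p"
    by (rule is_pole_transform) simp
  have "zorder (\<lambda>z. z / N z) ?p = -1"
    by (rule zorder_eqI[OF open_ball pin quot])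
       (use p Mnz[OF pin] fact in \<open>auto simp: power_int_minus divide_inverse\<close>)
  moreover have "(\<lambda>z. z / N z) holomorphic_on ball 0 1 - {?p}"
    by (intro holomorphic_intros holomorphic_on_subset[OF hol]) (use nz in auto)
  moreover have "deriv (\<lambda>z. z / N z) 0 = 1"
  proof -
    have "(N has_field_derivative deriv N 0) (at 0)"
      using hol holomorphic_derivI[of N "ball 0 1" 0] by auto
    then have "((\<lambda>z. z / N z) has_field_derivative 1) (at 0)"
      using N by (auto intro!: derivative_eq_intros)
    then show ?thesis by (rule DERIV_imp_deriv)
  qed
  ultimately show ?thesis
    using pole by (simp add: class_A_def)
qed

section \<open>Consequences of a bound on \<open>U_op\<close>\<close>

text \<open>The formula comes from (1/f)' = - f' / f^2. A zero of \<open>f\<close> would be a pole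
  of 1/f, hence of its derivative, and since the factor \<open>z\<^sup>2\<close> is nonzero there,
  \<open>U_op f\<close> would be unbounded nearby.\<close>

lemma class_A_U_bounded_nonzero:
  assumes f: "f \<in> class_A p" and U: "U_bounded f c" and p: "0 < p"
    and z: "z \<in> ball 0 1" "z \<noteq> 0" "z \<noteq> of_real p"
  shows "f z \<noteq> 0" and "U_op f z = - z\<^sup>2 * deriv (\<lambda>z. inverse (f z)) z - 1"
proof -
  define D where "D = ball 0 1 - {complex_of_real p}"
  have D: "open D" "connected D" "z \<in> D"
    using z by (auto simp: D_def open_delete intro!: connected_open_delete)
  have hol: "f holomorphic_on D" and d1: "deriv f 0 = 1"
    using f by (auto simp: class_A_def D_def)
  have U_eq: "U_op f w = - w\<^sup>2 * deriv (\<lambda>z. inverse (f z)) w - 1"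
    if w: "w \<in> D" "w \<noteq> 0" "f w \<noteq> 0" for w
  proof -
    have an: "f analytic_on {w}"
      using hol D(1) w(1) by (metis analytic_on_holomorphic empty_subsetI insert_subset)
    then have "(\<lambda>z. (z / f z)\<^sup>2 * deriv f z - 1) analytic_on {w}"
      using w by (intro analytic_intros analytic_deriv) auto
    then have "U_op f w = (w / f w)\<^sup>2 * deriv f w - 1"
      unfolding U_op_def by (rule remove_sings_at_analytic)
    moreover have "((\<lambda>z. inverse (f z)) has_field_derivative - (deriv f w / (f w)\<^sup>2)) (at w)"
      using holomorphic_derivI[OF hol D(1) w(1)] w(3)
      by (auto intro!: derivative_eq_intros simp: power2_eq_square field_simps)
    then have "deriv (\<lambda>z. inverse (f z)) w = - (deriv f w / (f w)\<^sup>2)"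
      by (rule DERIV_imp_deriv)
    ultimately show ?thesis
      by (simp add: power_divide)
  qed
  show nz: "f z \<noteq> 0"
  proof
    assume fz: "f z = 0"
    \<comment> \<open>Since \<open>f\<close> is not identically zero on the connected set
      \<open>D\<close>, its zeros are isolated; the formula \<open>U_eq\<close> is then available in
      a punctured neighbourhood of \<open>z\<close>.\<close>
    have "\<exists>b\<in>D. f b \<noteq> 0"
    proof (rule ccontr)
      assume "\<not> ?thesis"
      then have "eventually (\<lambda>w. f w = 0) (nhds 0)"
        using D(1) p by (intro eventually_nhds[THEN iffD2] exI[of _ D]) (auto simp: D_def)
      then have "deriv f 0 = deriv (\<lambda>_. 0) 0"
        by (intro deriv_cong_ev) auto
      with d1 show False by simp
    qed
    then obtain b where b: "b \<in> D" "f b \<noteq> 0" by blast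
    have ev: "eventually (\<lambda>w. f w \<noteq> 0 \<and> w \<in> D) (at z)"
      using non_zero_neighbour_alt[OF hol D b] .
    have an: "f analytic_on {z}"
      using hol D by (metis analytic_on_holomorphic empty_subsetI insert_subset)
    have tnd: "f \<midarrow>z\<rightarrow> 0"
      using analytic_at_imp_isCont[OF an] fz by (simp add: isCont_def)
    have "is_pole (\<lambda>z. inverse (f z)) z"
      unfolding is_pole_def
      by (rule filterlim_compose[OF filterlim_inverse_at_infinity])
         (use tnd ev in \<open>auto simp: filterlim_at elim: eventually_mono\<close>)
    moreover have "(\<lambda>z. inverse (f z)) meromorphic_on {z}"
      using an by (intro meromorphic_intros analytic_on_imp_meromorphic_on)
    ultimately have "is_pole (deriv (\<lambda>z. inverse (f z))) z"
      by (simp add: is_pole_deriv_iff)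
    then have "is_pole (\<lambda>w. w\<^sup>2 * deriv (\<lambda>z. inverse (f z)) w) z"
      by (rule is_pole_mult_analytic_nonzero1) (use z in \<open>auto intro!: analytic_intros\<close>)
    \<comment> \<open>The threshold \<open>c + 1\<close> absorbs the constant 1 that separates this
      product from \<open>U_op f w\<close> up to sign.\<close>
    then have "eventually (\<lambda>w. norm (w\<^sup>2 * deriv (\<lambda>z. inverse (f z)) w) \<ge> c + 1) (at z)"
      by (simp add: is_pole_def filterlim_at_infinity_conv_norm_at_top filterlim_at_top)
    moreover have "eventually (\<lambda>w. w \<noteq> 0) (at z)"
      by (rule eventually_neq_at_within)
    ultimately have "eventually (\<lambda>w. False) (at z)"
      using ev
    proof eventually_elim
      case (elim w)
      then have "norm (U_op f w) < c"
        using U by (simp add: U_bounded_def D_def)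
      then have "norm (- w\<^sup>2 * deriv (\<lambda>z. inverse (f z)) w - 1) < c"
        using U_eq[of w] elim by simp
      moreover have "norm (w\<^sup>2 * deriv (\<lambda>z. inverse (f z)) w)
          \<le> norm (- w\<^sup>2 * deriv (\<lambda>z. inverse (f z)) w - 1) + norm (1 :: complex)"
        using norm_triangle_ineq[of "- w\<^sup>2 * deriv (\<lambda>z. inverse (f z)) w - 1" 1] by simp
      ultimately show ?case using elim(1) by simp
    qed
    then show False by simp
  qed
  then show "U_op f z = - z\<^sup>2 * deriv (\<lambda>z. inverse (f z)) z - 1"
    using U_eq D(3) z by blast
qed

text \<open>On the circle of radius r the hypothesis reads |g| \<le> c / r^2. The maximum principle
  carries this inside, and r tends to 1.\<close>

lemma norm_le_if_norm_square_mult_le: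
  assumes hol: "g holomorphic_on ball 0 1"
    and le: "\<And>z. z \<in> ball 0 1 \<Longrightarrow> norm (z\<^sup>2 * g z) \<le> c" and z: "z \<in> ball 0 1"
  shows "norm (g z) \<le> c"
proof -
  have bound: "norm (g z) \<le> c / r\<^sup>2" if r: "norm z < r" "r < 1" for r
  proof (rule maximum_modulus_frontier[where S = "ball 0 r" and f = g and \<xi> = z])
    have r0: "0 < r" using r(1) norm_ge_zero le_less_trans by blast
    show "g holomorphic_on interior (ball 0 r)"
      using r hol by (auto intro: holomorphic_on_subset)
    show "continuous_on (closure (ball 0 r)) g"
      using r r0 by (intro continuous_on_subset[OF holomorphic_on_imp_continuous_on[OF hol]]) auto
    show "norm (g w) \<le> c / r\<^sup>2" if "w \<in> frontier (ball 0 r)" for w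
    proof -
      have "norm w = r" using that r0 by simp
      then show ?thesis
        using le[of w] r r0 by (simp add: norm_mult norm_power field_simps)
    qed
  qed (use r in auto)
  have "((\<lambda>r::real. c / r\<^sup>2) \<longlongrightarrow> c / 1\<^sup>2) (at_left 1)"
    by (intro tendsto_intros) auto
  moreover have "eventually (\<lambda>r. norm z < r \<and> r < 1) (at_left 1)"
    using z by (auto simp: eventually_at_left_field intro!: exI[of _ "norm z"])
  then have "eventually (\<lambda>r. norm (g z) \<le> c / r\<^sup>2) (at_left 1)"
    by eventually_elim (use bound in auto)
  ultimately show ?thesis
    by (metis div_by_1 one_power2 tendsto_lowerbound trivial_limit_at_left_real)
qed

text \<open>The function 1/f - 1/z extends to a holomorphic \<open>w\<close> on the disc with z^2 w'
  = - U_f, so |w'| \<le> c, and the disc is convex. The points \<open>0\<close> and \<open>p\<close>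
  are left out because there the expression in \<open>f\<close> need not agree with
  \<open>w\<close>.\<close>

lemma class_A_U_bounded_Lipschitz:
  assumes f: "f \<in> class_A p" and U: "U_bounded f c" and p: "0 < p" "p < 1"
    and a: "a \<in> ball 0 1" "a \<noteq> 0" "a \<noteq> of_real p"
    and b: "b \<in> ball 0 1" "b \<noteq> 0" "b \<noteq> of_real p"
  shows "norm ((1 / f a - 1 / a) - (1 / f b - 1 / b)) \<le> c * norm (a - b)"
proof -
  let ?p = "complex_of_real p"
  define D where "D = ball 0 1 - {?p}"
  have D: "open D" by (auto simp: D_def open_delete)
  have hol: "f holomorphic_on D" and pole: "is_pole f ?p" and f0: "f 0 = 0" "deriv f 0 = 1"
    using f by (auto simp: class_A_def D_def)
  note nz = class_A_U_bounded_nonzero(1)[OF f U p(1)]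
  note U_eq = class_A_U_bounded_nonzero(2)[OF f U p(1)]
  \<comment> \<open>This is f(z)/z, with the value f'(0) = 1 at \<open>0\<close>: the division
    removes the only zero of \<open>f\<close>.\<close>
  define g where "g = (\<lambda>z. if z = 0 then deriv f 0 else (f z - f 0) / (z - 0))"
  have g: "g holomorphic_on ball 0 1 - {?p}"
    unfolding g_def using pole_lemma_open[OF hol D] by (simp add: D_def)
  have gnz: "\<forall>z\<in>ball 0 1 - {?p}. g z \<noteq> 0"
    using nz f0 by (auto simp: g_def)
  have "is_pole (\<lambda>z. inverse z * f z) ?p"
    by (rule is_pole_mult_analytic_nonzero1[OF pole])
       (use p in \<open>auto intro!: analytic_intros\<close>)
  moreover have "eventually (\<lambda>z. z \<noteq> 0) (at ?p)"
    by (rule eventually_neq_at_within)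
  then have "eventually (\<lambda>z. inverse z * f z = g z) (at ?p)"
    by eventually_elim (auto simp: g_def f0 field_simps)
  ultimately have "is_pole g ?p"
    by (rule is_pole_transform) simp
  \<comment> \<open>This is z/f(z). The arbitrary value of \<open>g\<close> at its pole is replaced
    by \<open>0\<close>, the limit of the reciprocal.\<close>
  define N where "N = (\<lambda>z. if z = ?p then 0 else inverse (g z))"
  have N: "N holomorphic_on ball 0 1"
    unfolding N_def by (rule is_pole_inverse_holomorphic[OF open_ball g \<open>is_pole g ?p\<close> gnz])
  \<comment> \<open>As \<open>N 0 = 1\<close>, this is (N - 1)/z with its singularity at
    \<open>0\<close> removed.\<close>
  define w where "w = (\<lambda>z. if z = 0 then deriv N 0 else (N z - N 0) / (z - 0))"
  have w: "w holomorphic_on ball 0 1"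
    unfolding w_def using pole_lemma_open[OF N open_ball] .
  have w_eq: "w z = inverse (f z) - inverse z" if "z \<in> ball 0 1" "z \<noteq> 0" "z \<noteq> ?p" for z
    using that p f0 nz[OF that] by (simp add: w_def N_def g_def field_simps)
  have le: "norm (z\<^sup>2 * deriv w z) \<le> c" if z: "z \<in> ball 0 1 - {0, ?p}" for z
  proof -
    have op: "open (ball 0 1 - {0, ?p})"
      by (intro open_Diff finite_imp_closed) auto
    then have "eventually (\<lambda>z. z \<in> ball 0 1 - {0, ?p}) (nhds z)"
      using z by (rule eventually_nhds_in_open)
    then have "eventually (\<lambda>z. w z = inverse (f z) - inverse z) (nhds z)"
      by eventually_elim (use w_eq in auto)
    then have "deriv w z = deriv (\<lambda>z. inverse (f z) - inverse z) z"
      by (intro deriv_cong_ev) auto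
    also have "\<dots> = deriv (\<lambda>z. inverse (f z)) z - deriv inverse z"
    proof (rule deriv_diff)
      have "f field_differentiable (at z)"
        using hol D z by (auto simp: D_def holomorphic_on_imp_differentiable_at)
      then show "(\<lambda>z. inverse (f z)) field_differentiable (at z)"
        using nz[of z] z by (auto intro!: derivative_intros)
      show "inverse field_differentiable (at z)"
        using z field_differentiable_inverse[of "\<lambda>z. z" z UNIV] by auto
    qed
    also have "deriv inverse z = - (1 / z\<^sup>2)"
      using z by (intro DERIV_imp_deriv)
        (auto intro!: derivative_eq_intros simp: power2_eq_square field_simps)
    finally have "z\<^sup>2 * deriv w z = - U_op f z"
      using z U_eq[of z] by (simp add: distrib_left)
    then show ?thesis
      using U z by (auto simp: U_bounded_def intro: less_imp_le)
  qed
  \<comment> \<open>The bound passes to \<open>0\<close> and \<open>p\<close> by continuity.\<close>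
  have "norm (z\<^sup>2 * deriv w z) \<le> c" if z: "z \<in> ball 0 1" for z
  proof (rule tendsto_upperbound)
    have "(\<lambda>z. z\<^sup>2 * deriv w z) holomorphic_on ball 0 1"
      by (intro holomorphic_intros w) auto
    then have "isCont (\<lambda>z. z\<^sup>2 * deriv w z) z"
      using z by (meson continuous_on_eq_continuous_at holomorphic_on_imp_continuous_on open_ball)
    then show "(\<lambda>z. norm (z\<^sup>2 * deriv w z)) \<midarrow>z\<rightarrow> norm (z\<^sup>2 * deriv w z)"
      by (intro tendsto_norm) (simp add: isCont_def)
    have "eventually (\<lambda>w. w \<in> ball 0 1 - {z}) (at z)"
      using z by (intro eventually_at_in_open) auto
    moreover have "eventually (\<lambda>w. w \<noteq> 0) (at z)" "eventually (\<lambda>w. w \<noteq> ?p) (at z)"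
      by (auto intro: eventually_neq_at_within)
    ultimately show "eventually (\<lambda>z. norm (z\<^sup>2 * deriv w z) \<le> c) (at z)"
      by eventually_elim (use le in auto)
  qed auto
  then have "norm (deriv w z) \<le> c" if "z \<in> ball 0 1" for z
    using norm_le_if_norm_square_mult_le[OF holomorphic_deriv[OF w open_ball] _ that] by blast
  then have "norm (w a - w b) \<le> c * norm (a - b)"
    using a b w by (intro field_differentiable_bound[where S = "ball 0 1" and f' = "deriv w"])
      (auto intro: holomorphic_derivI has_field_derivative_at_within)
  then show ?thesis
    using a b by (simp add: w_eq inverse_eq_divide)
qed

section \<open>Univalence\<close>

lemma class_V_subset_Sigma:
  assumes p: "0 < p" "p < 1" and l: "l \<le> 1"
  shows "class_V p l \<subseteq> class_Sigma p"
proof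
  fix f assume "f \<in> class_V p l"
  then have f: "f \<in> class_A p" and U: "U_bounded f l"
    by (auto simp: class_V_def)
  have f0: "f 0 = 0" using f by (auto simp: class_A_def)
  note nz = class_A_U_bounded_nonzero(1)[OF f U p(1)]
  have inj: "a = b" if a: "a \<in> ball 0 1" "a \<noteq> of_real p"
    and b: "b \<in> ball 0 1" "b \<noteq> of_real p" and eq: "f a = f b" for a b
  \<comment> \<open>The Lipschitz estimate says nothing at \<open>0\<close>; there injectivity is
    the absence of further zeros.\<close>
  proof (cases "a = 0 \<or> b = 0")
    case True
    then show ?thesis using nz a b eq f0 by metis
  next
    case False
    show ?thesis
    proof (rule ccontr)
      assume ne: "a \<noteq> b"
      have "norm ((a - b) / (a * b)) \<le> l * norm (a - b)"
        using class_A_U_bounded_Lipschitz[OF f U p, of a b] a b False eq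
        by (simp add: field_simps)
      then have "norm (a - b) / (norm a * norm b) \<le> l * norm (a - b)"
        by (simp add: norm_divide norm_mult)
      then have "1 \<le> l * (norm a * norm b)"
        using ne False by (simp add: field_simps)
      also have "\<dots> \<le> 1 * (norm a * norm b)"
        using l by (intro mult_right_mono) auto
      \<comment> \<open>Strictness comes from |a b| < 1 alone, so the case \<open>l = 1\<close> is
        covered.\<close>
      also have "\<dots> < 1"
        using a b mult_strict_mono[of "norm a" 1 "norm b" 1] by auto
      finally show False by simp
    qed
  qed
  have "inj_on (sphere_map p f) (ball 0 1)"
    by (rule inj_onI) (auto simp: sphere_map_def intro: inj split: if_splits)
  then show "f \<in> class_Sigma p"
    using f by (simp add: class_Sigma_def)
qed

section \<open>Examples showing that the inclusions are proper\<close>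

text \<open>The expression N - z N' - 1 annihilates the constant term 1 and the linear term of
  \<open>N\<close>. So the quadratic coefficient \<open>l\<close> alone fixes U_f, and the linear
  one is free to place a root at \<open>p\<close>; the other root 1/(l p) lies outside the
  disc.\<close>

lemma class_V_not_subset_U:
  assumes p: "0 < p" "p < 1" and l: "0 < l" "l \<le> 1"
  shows "\<exists>f. f \<in> class_V p l \<and> f \<notin> class_U p l"
proof -
  define N :: "complex \<Rightarrow> complex" where "N = (\<lambda>z. 1 - z * of_real (1 / p + l * p) + of_real l * z\<^sup>2)"
  have hol: "N holomorphic_on ball 0 1"
    unfolding N_def by (intro holomorphic_intros)
  have dN: "deriv N z = - of_real (1 / p + l * p) + 2 * of_real l * z" for z :: complex
    unfolding N_def by (intro DERIV_imp_deriv) (auto intro!: derivative_eq_intros)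
  have lp: "l * p < 1"
    using p l mult_le_less_imp_less[of l 1 p 1] by auto
  have fac: "N z = (1 - z / p) * (1 - l * p * z)" for z :: complex
    using p by (simp add: N_def field_simps power2_eq_square)
  have nz: "N z \<noteq> 0" if z: "z \<in> ball 0 1" "z \<noteq> complex_of_real p" for z
  proof -
    have "norm (l * p * z) < 1"
      using z lp p l mult_strict_mono[of "l * p" 1 "norm z" 1] by (auto simp: norm_mult)
    then have "1 - l * p * z \<noteq> 0" by auto
    then show ?thesis using z p by (simp add: fac)
  qed
  have "deriv N p = of_real (l * p - 1 / p)"
    by (simp add: dN)
  moreover have "l * p - 1 / p < 0"
    using lp p less_divide_eq_1_pos[of p 1] by linarith
  ultimately have "deriv N p \<noteq> 0"
    by (metis less_irrefl of_real_eq_0_iff)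
  moreover have "N 0 = 1" "N p = 0"
    using p by (simp_all add: fac)
  ultimately have A: "(\<lambda>z. z / N z) \<in> class_A p"
    using p by (intro quotient_in_class_A[OF hol nz])
  have U: "N z - z * deriv N z - 1 = - (l * z\<^sup>2)" for z :: complex
    by (simp add: dN) (simp add: N_def algebra_simps power2_eq_square)
  have bd: "U_bounded (\<lambda>z. z / N z) c \<longleftrightarrow> (\<forall>z\<in>ball (0::complex) 1. l * (norm z)\<^sup>2 < c)" for c
  proof -
    have "U_bounded (\<lambda>z. z / N z) c \<longleftrightarrow> (\<forall>z\<in>ball 0 1. norm (N z - z * deriv N z - 1) < c)"
      using U_bounded_quotient[of N "of_real p"] hol nz by blast
    then show ?thesis
      using l unfolding U by (simp add: norm_mult norm_power)
  qed
  have "U_bounded (\<lambda>z. z / N z) l"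
    using l by (auto simp: bd power_less_one_iff abs_square_less_1)
  moreover have "\<not> U_bounded (\<lambda>z. z / N z) (l * mu p)"
  proof -
    \<comment> \<open>The square of this point is \<open>mu p\<close>, so |U_f| equals the bound
      \<open>l * mu p\<close> there and the strict inequality fails.\<close>
    let ?z = "complex_of_real ((1 - p) / (1 + p))"
    have "norm ?z = (1 - p) / (1 + p)"
      unfolding norm_of_real using p by simp
    then have "?z \<in> ball 0 1" "l * (norm ?z)\<^sup>2 = l * mu p"
      using p by (simp_all add: mu_def)
    then show ?thesis
      unfolding bd by (metis less_irrefl)
  qed
  ultimately show ?thesis
    using A by (auto simp: class_V_def class_U_def)
qed

text \<open>Subtracting a constant from 1/k follows k by a Moebius map, which keeps univalence, and
  moves the pole to \<open>p\<close>. It alters \<open>N\<close> only by a linear term, so U_k is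
  unchanged. One point with |U_k| > 1 suffices.\<close>

lemma class_Sigma_not_subset_V:
  assumes p: "0 < p" "p < 1" and l: "l \<le> 1"
  shows "\<exists>f. f \<in> class_Sigma p \<and> f \<notin> class_V p l"
proof -
  let ?p = "complex_of_real p"
  define s where "s = (\<lambda>z::complex. csqrt (1 - z))"
  define c where "c = (1 + s ?p) / (2 * ?p)"
  \<comment> \<open>Since \<open>(1 - s z) * (1 + s z) = z\<close>, this is \<open>z / k z - z / k p\<close> for \<open>k z = 2 * (1 - s z)\<close>.\<close>
  define N where "N = (\<lambda>z. (1 + s z) / 2 - c * z)"
  have s2: "(s z)\<^sup>2 = 1 - z" for z by (simp add: s_def)
  have slit: "1 - z \<notin> \<real>\<^sub>\<le>\<^sub>0" if "z \<in> ball 0 1" for z :: complex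
    using that complex_Re_le_cmod[of z] by (auto simp: complex_nonpos_Reals_iff)
  have s1: "1 + s z \<noteq> 0" for z
  proof -
    have "Re (s z) \<ge> 0"
      using csqrt_principal[of "1 - z"] by (auto simp: s_def)
    then show ?thesis by (auto simp: complex_eq_iff)
  qed
  \<comment> \<open>The hypothesis is the cross-multiplied form of 1 - s(a) = 1 - s(b), because z/(1
    + s(z)) = 1 - s(z). It serves both to exclude zeros of \<open>N\<close> other than
    \<open>p\<close> and to prove univalence.\<close>
  have s_inj: "a = b" if "a * (1 + s b) = b * (1 + s a)" for a b
  proof -
    have "a = (1 - s a) * (1 + s a)" "b = (1 - s b) * (1 + s b)"
      using s2[of a] s2[of b] by (simp_all add: algebra_simps power2_eq_square)
    then have "(1 - s a) * ((1 + s a) * (1 + s b)) = (1 - s b) * ((1 + s a) * (1 + s b))"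
      using that by (metis mult.assoc mult.commute)
    then have "s a = s b" using s1 by simp
    then have "1 - a = 1 - b" using s2 by metis
    then show ?thesis by simp
  qed
  have dN: "(N has_field_derivative - 1 / (4 * s z) - c) (at z)" if "z \<in> ball 0 1" for z
    unfolding N_def s_def using slit[OF that]
    by (auto intro!: derivative_eq_intros)
  have hol: "N holomorphic_on ball 0 1"
    using dN by (meson holomorphic_on_open open_ball)
  have Np: "N ?p = 0" using p by (simp add: N_def c_def)
  have nz: "N z \<noteq> 0" if "z \<in> ball 0 1" "z \<noteq> ?p" for z
  proof
    assume "N z = 0"
    moreover have "N z = (?p * (1 + s z) - z * (1 + s ?p)) / (2 * ?p)"
      using p by (simp add: N_def c_def field_simps)
    ultimately have "z * (1 + s ?p) = ?p * (1 + s z)"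
      using p by simp
    then show False using s_inj[of z ?p] that by simp
  qed
  have sp: "s (of_real x) = of_real (sqrt (1 - x))" if "x \<le> 1" for x
    using that of_real_sqrt[of "1 - x"] by (simp add: s_def)
  have "deriv N ?p = of_real (- 1 / (4 * sqrt (1 - p)) - (1 + sqrt (1 - p)) / (2 * p))"
    using p DERIV_imp_deriv[OF dN, of ?p] by (simp add: c_def sp)
  moreover have "- 1 / (4 * sqrt (1 - p)) - (1 + sqrt (1 - p)) / (2 * p) < 0"
  proof -
    have "0 < sqrt (1 - p)" using p by simp
    then have "0 < 1 / (4 * sqrt (1 - p))" "0 < (1 + sqrt (1 - p)) / (2 * p)"
      using p by (auto intro!: divide_pos_pos add_pos_pos)
    then show ?thesis by linarith
  qed
  ultimately have "deriv N ?p \<noteq> 0"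
    by (metis less_irrefl of_real_eq_0_iff)
  then have A: "(\<lambda>z. z / N z) \<in> class_A p"
    using p Np by (intro quotient_in_class_A[OF hol nz]) (auto simp: N_def s_def)
  have inj: "a = b" if ab: "a \<in> ball 0 1" "a \<noteq> ?p" "b \<in> ball 0 1" "b \<noteq> ?p"
    and eq: "a / N a = b / N b" for a b
  proof (rule s_inj)
    have "a * N b = b * N a"
      using eq nz ab by (simp add: field_simps)
    \<comment> \<open>After substitution the linear part contributes 2 c a b to both sides and
      cancels.\<close>
    moreover have "1 + s z = 2 * N z + 2 * c * z" for z
      by (simp add: N_def field_simps)
    ultimately show "a * (1 + s b) = b * (1 + s a)"
      by (simp add: algebra_simps)
  qed
  have "inj_on (sphere_map p (\<lambda>z. z / N z)) (ball 0 1)"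
    by (rule inj_onI) (auto simp: sphere_map_def intro: inj split: if_splits)
  then have "(\<lambda>z. z / N z) \<in> class_Sigma p"
    using A by (simp add: class_Sigma_def)
  moreover have "\<not> U_bounded (\<lambda>z. z / N z) l"
  proof -
    \<comment> \<open>Here 1 - z = 1/36 is a perfect square, which makes U_f rational: its value
      25/24 exceeds 1, hence \<open>l\<close>.\<close>
    let ?z = "complex_of_real (35 / 36)"
    have z: "?z \<in> ball 0 1" by simp
    have sq: "sqrt (1 - 35 / 36) = 1 / 6"
      by (rule real_sqrt_unique) (auto simp: power2_eq_square)
    have sz: "s ?z = of_real (1 / 6)"
      using sp[of "35 / 36"] unfolding sq by simp
    have "N ?z - ?z * deriv N ?z - 1 = (1 + s ?z) / 2 + ?z / (4 * s ?z) - 1"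
      unfolding DERIV_imp_deriv[OF dN[OF z]] by (simp add: N_def right_diff_distrib)
    also have "\<dots> = of_real (25 / 24)"
      unfolding sz by simp
    finally have "norm (N ?z - ?z * deriv N ?z - 1) = 25 / 24"
      by (metis abs_of_nonneg divide_nonneg_nonneg norm_of_real zero_le_numeral)
    moreover have "U_bounded (\<lambda>z. z / N z) l \<longleftrightarrow> (\<forall>z\<in>ball 0 1. norm (N z - z * deriv N z - 1) < l)"
      using U_bounded_quotient[of N ?p l] hol nz by blast
    ultimately show ?thesis
      using l by (intro notI) (drule iffD1, assumption, drule bspec[OF _ z], linarith)
  qed
  ultimately show ?thesis
    by (auto simp: class_V_def)
qed

theorem mainTheorem2:
  fixes p l :: real
  assumes "0 < p" "p < 1" "0 < l" "l \<le> 1"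
  shows "class_U p l \<subset> class_V p l \<and> class_V p l \<subset> class_Sigma p"
proof -
  have "mu p \<le> 1"
    using assms by (simp add: mu_def power_le_one)
  then have "l * mu p \<le> l"
    using assms by (simp add: mult_left_le)
  then have "class_U p l \<subseteq> class_V p l"
    by (fastforce simp: class_U_def class_V_def U_bounded_def)
  then show ?thesis
    using class_V_not_subset_U[OF assms] class_Sigma_not_subset_V[OF assms(1,2,4)]
      class_V_subset_Sigma[OF assms(1,2,4)] by blast
qed

end
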